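(* For every integer $n\ge 2$, the labeled tree-like tableaux of size $n$ are in bijection with the staircase tableaux of size $n-1$.
   Context: **Staircase tableaux.** A staircase tableau $\mathcal{T}$ of size $m$ is a Ferrers diagram of shape $(m,m-1,\dots,2,1)$ (English convention: rows left-justified, longest row on top) whose boxes are either empty or labeled with one of $\alpha,\beta,\gamma,\delta$, such that: no box along the diagonal (the last box of each row) is empty; all boxes in the same row and to the left of a $\beta$ or a $\delta$ are empty; all boxes in the same column and above an $\alpha$ or a $\gamma$ are empty. **Ferrers diagrams and border edges.** The border edges of a Ferrers diagram $D$ are the edges that stand at the end of rows (vertical border edges, one per row, at the right end of the row) or of columns (horizontal border edges, one per column, at the bottom of the column). Their number is the half-perimeter of $D$ (number of rows plus number of columns). For a box $c$ of $D$, $L_D(c)$ is the set of boxes in the same column as $c$ and above $c$, and $A_D(c)$ is the set of boxes in the same row as $c$ and to the left of $c$. The same notation is used for a tableau $T$ of shape $D$. **Labeled tree-like tableaux.** A labeled tree-like tableau (LTLT) $T$ of size $n$ is a Ferrers diagram of half-perimeter $n+1$ in which some boxes (at most one label per box) and all border edges are labeled with $1,\alpha,\beta,\gamma$ or $\delta$, such that: - the Northwestern-most box (root box) is labeled by $1$; - the labels in the first row and the first column are the only labels $1$ (i.e. every label in the first row or first column equals $1$, including the label of the vertical border edge at the end of the first row and of the horizontal border edge at the bottom of the first column, and no other label is $1$); - every vertical border edge not in the first row is labeled $\alpha$ or $\gamma$, and every horizontal border edge not in the first column is labeled $\beta$ or $\delta$; - in each row and each column there is at least one labeled box; - for each box $c$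 labeled by $\alpha$ or $\gamma$, all boxes in $L_T(c)$ are empty and at least one box in $A_T(c)$ is labeled; - for each box $c$ labeled by $\beta$ or $\delta$, all boxes in $A_T(c)$ are empty and at least one box in $L_T(c)$ is labeled. The horizontal border edge at the bottom of a column other than the first, and the vertical border edge at the end of a row other than the first, are not considered to lie in the first row or first column, even if that column or row consists of a single box. *)

theory Defs
  imports Main
begin

text \<open>
  A Ferrers diagram is given by its list of row lengths (from top to bottom). Boxes are pairs
  \<open>(i, j)\<close> of a row index and a column index, both counted from 0 starting at the Northwestern
  corner. Empty rows are excluded, so the diagram and the list determine each other.
\<close>

definition ferrers :: "nat list \<Rightarrow> bool" where
  "ferrers D \<longleftrightarrow> sorted_wrt (\<ge>) D \<and> (\<forall>r\<in>set D. 0 < r)"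

definition boxes :: "nat list \<Rightarrow> (nat \<times> nat) set" where
  "boxes D = {(i, j). i < length D \<and> j < D ! i}"

definition num_rows :: "nat list \<Rightarrow> nat" where
  "num_rows D = length D"

definition num_cols :: "nat list \<Rightarrow> nat" where
  "num_cols D = (case D of [] \<Rightarrow> 0 | r # _ \<Rightarrow> r)"

definition half_perimeter :: "nat list \<Rightarrow> nat" where
  "half_perimeter D = num_rows D + num_cols D"

text \<open>\<open>above D c\<close> is $L_D(c)$ and \<open>left_of D c\<close> is $A_D(c)$.\<close>

definition above :: "nat list \<Rightarrow> nat \<times> nat \<Rightarrow> (nat \<times> nat) set" where
  "above D c = {b \<in> boxes D. snd b = snd c \<and> fst b < fst c}"

definition left_of :: "nat list \<Rightarrow> nat \<times> nat \<Rightarrow> (nat \<times> nat) set" where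
  "left_of D c = {b \<in> boxes D. fst b = fst c \<and> snd b < snd c}"

datatype label = LOne | LAlpha | LBeta | LGamma | LDelta

text \<open>
  A filling is a partial map on boxes; \<open>None\<close> means that the box is empty. Its domain is
  confined to the diagram, so that equal tableaux are equal as HOL values.
\<close>

type_synonym filling = "nat \<times> nat \<rightharpoonup> label"

definition staircase_shape :: "nat \<Rightarrow> nat list" where
  "staircase_shape m = rev [1..<Suc m]"

definition staircase_tableaux :: "nat \<Rightarrow> filling set" where
  "staircase_tableaux m = {T. let D = staircase_shape m in
     dom T \<subseteq> boxes D \<and>
     ran T \<subseteq> {LAlpha, LBeta, LGamma, LDelta} \<and>
     (\<forall>i < num_rows D. T (i, D ! i - 1) \<noteq> None) \<and>
     (\<forall>c \<in> boxes D. T c \<in> {Some LBeta, Some LDelta} \<longrightarrow> (\<forall>b \<in> left_of D c. T b = None)) \<and>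
     (\<forall>c \<in> boxes D. T c \<in> {Some LAlpha, Some LGamma} \<longrightarrow> (\<forall>b \<in> above D c. T b = None))}"

text \<open>
  Border edges are indexed by the row (vertical edges) or the column (horizontal edges) that they
  close; every one of them carries a label.
\<close>

record ltlt =
  shape :: "nat list"
  box_label :: filling
  vedge_label :: "nat \<rightharpoonup> label"
  hedge_label :: "nat \<rightharpoonup> label"

definition labeled_tree_like_tableaux :: "nat \<Rightarrow> ltlt set" where
  "labeled_tree_like_tableaux n = {X.
     let D = shape X; T = box_label X; V = vedge_label X; H = hedge_label X in
     ferrers D \<and> half_perimeter D = n + 1 \<and>
     dom T \<subseteq> boxes D \<and> dom V = {..<num_rows D} \<and> dom H = {..<num_cols D} \<and>
     T (0, 0) = Some LOne \<and>
     (\<forall>i j l. T (i, j) = Some l \<longrightarrow> (l = LOne \<longleftrightarrow> i = 0 \<or> j = 0)) \<and>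
     V 0 = Some LOne \<and> H 0 = Some LOne \<and>
     (\<forall>i. 0 < i \<and> i < num_rows D \<longrightarrow> V i \<in> {Some LAlpha, Some LGamma}) \<and>
     (\<forall>j. 0 < j \<and> j < num_cols D \<longrightarrow> H j \<in> {Some LBeta, Some LDelta}) \<and>
     (\<forall>i < num_rows D. \<exists>j. (i, j) \<in> boxes D \<and> T (i, j) \<noteq> None) \<and>
     (\<forall>j < num_cols D. \<exists>i. (i, j) \<in> boxes D \<and> T (i, j) \<noteq> None) \<and>
     (\<forall>c \<in> boxes D. T c \<in> {Some LAlpha, Some LGamma} \<longrightarrow>
        (\<forall>b \<in> above D c. T b = None) \<and> (\<exists>b \<in> left_of D c. T b \<noteq> None)) \<and>
     (\<forall>c \<in> boxes D. T c \<in> {Some LBeta, Some LDelta} \<longrightarrow>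
        (\<forall>b \<in> left_of D c. T b = None) \<and> (\<exists>b \<in> above D c. T b \<noteq> None))}"

end

theory Submission
  imports Defs
begin

text \<open>
  The bijection is explicit. In a staircase tableau, a diagonal box labeled \<open>\<alpha>\<close> or \<open>\<gamma>\<close>
  empties the rest of its column, and one labeled \<open>\<beta>\<close> or \<open>\<delta>\<close> empties the rest of
  its row. Deleting these columns and rows loses only the diagonal labels, and these form a word
  of \<open>m\<close> letters. The boxes that remain form a Ferrers diagram (possibly with
  empty rows or columns) whose border is this word read from Northeast to Southwest: a row of the
  diagram ends at each \<open>\<alpha>\<close> or \<open>\<gamma>\<close>, and a column ends at each \<open>\<beta>\<close> or
  \<open>\<delta>\<close>. The diagonal labels become labels of border edges of exactly the allowed kind, and the
  conditions on the remaining labels are the same on both sides, except that a tree-like tableau also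
  demands that a labeled box has another labeled box to its left or above it, and that no row or
  column is empty.

  The extra row and column of 1s take care of that demand. In a tree-like tableau they are determined
  by the rest: the box on top of a column is labeled exactly if the column has no \<open>\<alpha>\<close> and no
  \<open>\<gamma>\<close>, and symmetrically for rows (\<open>mem_labeled_tree_like_tableaux_iff\<close>). Conversely,
  this choice makes every filling of the inner boxes that respects the emptiness conditions into a
  tree-like tableau. Prepending such a row and column raises the half-perimeter from \<open>m\<close> to
  \<open>m + 2\<close>, which is size \<open>m + 1\<close>.

  On shapes, the correspondence comes down to three facts. If row \<open>i\<close> of a Ferrers diagram
  ends at position \<open>row_pos D i\<close> of the inner border, then row \<open>i\<close> and
  column \<open>j\<close> meet in the diagram exactly if their staircase row and staircase column meet strictly
  above the diagonal (\<open>pos_sum_cases\<close>). Each diagonal box comes from exactly one border edge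
  (\<open>mem_col_set_iff\<close>). Finally, every subset of the border positions is the set of row ends of
  exactly one diagram (\<open>shape_eq_if_row_set_eq\<close>, \<open>ex_shape_with_row_set\<close>).
\<close>

section \<open>Labels\<close>

definition alpha_gamma :: "label option set" where
  "alpha_gamma = {Some LAlpha, Some LGamma}"

definition beta_delta :: "label option set" where
  "beta_delta = {Some LBeta, Some LDelta}"

lemma alpha_gamma_beta_delta_simps [simp]:
  "None \<notin> alpha_gamma" "Some LOne \<notin> alpha_gamma" "None \<notin> beta_delta" "Some LOne \<notin> beta_delta"
  "x \<in> alpha_gamma \<Longrightarrow> x \<notin> beta_delta"
  "x \<in> alpha_gamma \<Longrightarrow> x \<noteq> None" "x \<in> alpha_gamma \<Longrightarrow> \<exists>l. x = Some l"
  "x \<in> beta_delta \<Longrightarrow> x \<noteq> None" "x \<in> beta_delta \<Longrightarrow> \<exists>l. x = Some l"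
  by (auto simp: alpha_gamma_def beta_delta_def)

lemma label_cases: "x = None \<or> x = Some LOne \<or> x \<in> alpha_gamma \<or> x \<in> beta_delta"
proof (cases x)
  case (Some l)
  then show ?thesis by (cases l) (auto simp: alpha_gamma_def beta_delta_def)
qed simp

section \<open>Boxes above and to the left\<close>

lemma above_eq: "above D (i, j) = {(i', j) | i'. i' < i \<and> (i', j) \<in> boxes D}"
  by (auto simp: above_def)

lemma left_of_eq: "left_of D (i, j) = {(i, j') | j'. j' < j \<and> (i, j') \<in> boxes D}"
  by (auto simp: left_of_def)

section \<open>The border of a Ferrers diagram\<close>

definition col_height :: "nat list \<Rightarrow> nat \<Rightarrow> nat" where
  "col_height D j = card {i. i < length D \<and> j < D ! i}"

text \<open>
  The border of the diagram without its first row and column is a path of \<open>m\<close> edges from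
  Northeast to Southwest. Before the vertical edge of row \<open>i\<close> it passes the vertical edges of the
  \<open>i - 1\<close> inner rows above and the horizontal edges of the columns that are too short to reach
  row \<open>i\<close>; this number is \<open>row_pos D i\<close>. In \<open>col_pos\<close> the path is read in the
  opposite direction. These are the row and the column of the staircase into which row \<open>i\<close> and
  column \<open>j\<close> are moved.
\<close>

definition row_pos :: "nat list \<Rightarrow> nat \<Rightarrow> nat" where
  "row_pos D i = (i - 1) + (num_cols D - D ! i)"

definition col_pos :: "nat list \<Rightarrow> nat \<Rightarrow> nat" where
  "col_pos D j = (j - 1) + (num_rows D - col_height D j)"

definition row_set :: "nat list \<Rightarrow> nat set" where
  "row_set D = row_pos D ` {1..<num_rows D}"

definition col_set :: "nat list \<Rightarrow> nat set" where
  "col_set D = col_pos D ` {1..<num_cols D}"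

lemma down_closed_eq_lessThan:
  fixes A :: "nat set"
  assumes fin: "finite A" and down: "\<And>x y. y \<in> A \<Longrightarrow> x < y \<Longrightarrow> x \<in> A"
  shows "A = {..<card A}"
proof -
  obtain b where b: "b \<notin> A" using fin ex_new_if_finite infinite_UNIV_nat by blast
  define k where "k = (LEAST x. x \<notin> A)"
  have k: "k \<notin> A" unfolding k_def using b by (rule LeastI)
  have "x \<in> A" if "x < k" for x using not_less_Least that unfolding k_def by blast
  moreover have "x < k" if "x \<in> A" for x using that k down by (metis linorder_neqE_nat)
  ultimately have "A = {..<k}" by auto
  then show ?thesis by simp
qed

locale ferrers_diagram =
  fixes D :: "nat list" and m :: nat
  assumes ferrers: "ferrers D" and half_perimeter: "half_perimeter D = m + 2"
begin

lemma num_cols_nth: "D \<noteq> [] \<and> num_cols D = D ! 0"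
  using half_perimeter by (cases D) (auto simp: half_perimeter_def num_rows_def num_cols_def)

lemma rows_cols: "num_rows D + num_cols D = m + 2" "1 \<le> num_rows D" "1 \<le> num_cols D"
  using half_perimeter num_cols_nth ferrers
  by (auto simp: half_perimeter_def ferrers_def num_rows_def Suc_le_eq)

lemma row_length_antimono: "i \<le> i' \<Longrightarrow> i' < num_rows D \<Longrightarrow> D ! i' \<le> D ! i"
  using ferrers unfolding ferrers_def num_rows_def
  by (cases "i = i'") (auto simp: sorted_wrt_iff_nth_less)

lemma row_length_bounds: "i < num_rows D \<Longrightarrow> 0 < D ! i \<and> D ! i \<le> num_cols D"
  using ferrers row_length_antimono[of 0 i] num_cols_nth by (auto simp: ferrers_def num_rows_def)

lemma less_row_length_iff: "i < num_rows D \<Longrightarrow> j < D ! i \<longleftrightarrow> i < col_height D j"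
proof -
  assume i: "i < num_rows D"
  let ?A = "{i. i < length D \<and> j < D ! i}"
  have "?A = {..<card ?A}"
  proof (rule down_closed_eq_lessThan)
    fix x y assume "y \<in> ?A" "x < y"
    then show "x \<in> ?A" using row_length_antimono[of x y] by (auto simp: num_rows_def)
  qed simp
  then have "i \<in> ?A \<longleftrightarrow> i < col_height D j" unfolding col_height_def by blast
  then show ?thesis using i by (simp add: num_rows_def)
qed

lemma col_height_bounds: "j < num_cols D \<Longrightarrow> 0 < col_height D j \<and> col_height D j \<le> num_rows D"
proof
  assume "j < num_cols D"
  then show "0 < col_height D j" using less_row_length_iff[of 0 j] num_cols_nth rows_cols by simp
  have "col_height D j \<le> card {..<length D}"
    unfolding col_height_def by (rule card_mono) auto
  then show "col_height D j \<le> num_rows D" by (simp add: num_rows_def)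
qed

lemma col_height_antimono: "j \<le> j' \<Longrightarrow> col_height D j' \<le> col_height D j"
  unfolding col_height_def by (rule card_mono) auto

lemma mem_boxes_iff: "(i, j) \<in> boxes D \<longleftrightarrow> i < num_rows D \<and> j < D ! i"
  by (auto simp: boxes_def num_rows_def)

lemma mem_boxesD: "(i, j) \<in> boxes D \<Longrightarrow> i < num_rows D \<and> j < num_cols D"
  using row_length_bounds[of i] by (auto simp: mem_boxes_iff)

lemma first_row_col_boxes: "(0, j) \<in> boxes D \<longleftrightarrow> j < num_cols D" "(i, 0) \<in> boxes D \<longleftrightarrow> i < num_rows D"
  using row_length_bounds num_cols_nth rows_cols by (auto simp: mem_boxes_iff)

lemma row_pos_strict_mono: "i < i' \<Longrightarrow> 1 \<le> i \<Longrightarrow> i' < num_rows D \<Longrightarrow> row_pos D i < row_pos D i'"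
  using row_length_antimono[of i i'] unfolding row_pos_def by linarith

lemma col_pos_strict_mono: "j < j' \<Longrightarrow> 1 \<le> j \<Longrightarrow> col_pos D j < col_pos D j'"
  using col_height_antimono[of j j'] unfolding col_pos_def by linarith

lemma row_pos_inj: "inj_on (row_pos D) {1..<num_rows D}"
  by (rule linorder_inj_onI') (auto dest: row_pos_strict_mono)

lemma col_pos_inj: "inj_on (col_pos D) {1..<num_cols D}"
  by (rule linorder_inj_onI') (auto dest: col_pos_strict_mono)

lemma row_pos_less_iff:
  "i \<in> {1..<num_rows D} \<Longrightarrow> i' \<in> {1..<num_rows D} \<Longrightarrow> row_pos D i < row_pos D i' \<longleftrightarrow> i < i'"
  using row_pos_strict_mono[of i i'] row_pos_strict_mono[of i' i] by (cases i i' rule: linorder_cases) auto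

lemma col_pos_less_iff:
  "j \<in> {1..<num_cols D} \<Longrightarrow> j' \<in> {1..<num_cols D} \<Longrightarrow> col_pos D j < col_pos D j' \<longleftrightarrow> j < j'"
  using col_pos_strict_mono[of j j'] col_pos_strict_mono[of j' j] by (cases j j' rule: linorder_cases) auto

lemma row_pos_less: "i \<in> {1..<num_rows D} \<Longrightarrow> row_pos D i < m"
  using row_length_bounds[of i] rows_cols unfolding row_pos_def by auto

lemma col_pos_less: "j \<in> {1..<num_cols D} \<Longrightarrow> col_pos D j < m"
  using col_height_bounds[of j] rows_cols unfolding col_pos_def by auto

text \<open>
  The sum is \<open>m + (i - D ! i) + (j - col_height D j)\<close>. If \<open>(i, j)\<close> is a box, then
  \<open>j < D ! i\<close> and \<open>i < col_height D j\<close>, so it is at most \<open>m - 2\<close>; otherwise both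
  inequalities fail and it is at least \<open>m\<close>. The value \<open>m - 1\<close> in the gap is the
  diagonal of the staircase.
\<close>

lemma pos_sum_cases:
  assumes i: "i \<in> {1..<num_rows D}" and j: "j \<in> {1..<num_cols D}"
  shows "if (i, j) \<in> boxes D then row_pos D i + col_pos D j + 1 < m
         else m < row_pos D i + col_pos D j + 1"
  using i j rows_cols(1) row_length_bounds[of i] col_height_bounds[of j] less_row_length_iff[of i j]
  unfolding row_pos_def col_pos_def mem_boxes_iff by auto

lemma row_set_less: "r \<in> row_set D \<Longrightarrow> r < m"
  using row_pos_less by (auto simp: row_set_def)

lemma col_set_less: "c \<in> col_set D \<Longrightarrow> c < m"
  using col_pos_less by (auto simp: col_set_def)

lemma card_row_set: "card (row_set D) = num_rows D - 1"
  unfolding row_set_def using card_image[OF row_pos_inj] by simp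

lemma card_col_set: "card (col_set D) = num_cols D - 1"
  unfolding col_set_def using card_image[OF col_pos_inj] by simp

lemma row_set_col_set_disjoint: "r \<in> row_set D \<Longrightarrow> c \<in> col_set D \<Longrightarrow> r + c + 1 \<noteq> m"
  using pos_sum_cases unfolding row_set_def col_set_def by (fastforce split: if_splits)

text \<open>
  The diagonal box in row \<open>r\<close> and column \<open>c\<close> stands for a single border edge: the gap in
  \<open>pos_sum_cases\<close> shows that it cannot be both vertical and horizontal, and there are as many
  inner rows and columns together as there are diagonal boxes.
\<close>

lemma mem_col_set_iff:
  assumes "r + c + 1 = m"
  shows "c \<in> col_set D \<longleftrightarrow> r \<notin> row_set D"
proof
  assume "c \<in> col_set D"
  then show "r \<notin> row_set D" using row_set_col_set_disjoint assms by blast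
next
  assume r: "r \<notin> row_set D"
  let ?C = "(\<lambda>c. m - 1 - c) ` col_set D"
  have inj: "inj_on (\<lambda>c. m - 1 - c) (col_set D)"
  proof (rule inj_onI)
    fix c c' assume "c \<in> col_set D" "c' \<in> col_set D" "m - 1 - c = m - 1 - c'"
    then show "c = c'" using col_set_less[of c] col_set_less[of c'] by linarith
  qed
  have disj: "row_set D \<inter> ?C = {}"
    using row_set_col_set_disjoint col_set_less by fastforce
  have "card (row_set D \<union> ?C) = card (row_set D) + card ?C"
    by (rule card_Un_disjoint) (use disj in \<open>auto simp: row_set_def col_set_def\<close>)
  also have "\<dots> = m"
    using card_row_set card_col_set card_image[OF inj] rows_cols by simp
  finally have "row_set D \<union> ?C = {..<m}"
    using row_set_less col_set_less by (intro card_subset_eq) fastforce+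
  then have "r \<in> ?C" using r assms by auto
  then obtain c' where "c' \<in> col_set D" "r = m - 1 - c'" by blast
  moreover have "c = c'" using calculation col_set_less[of c'] assms by simp
  ultimately show "c \<in> col_set D" by simp
qed

lemma map_row_pos: "map (row_pos D) [1..<num_rows D] = sorted_list_of_set (row_set D)"
proof (rule strict_sorted_equal)
  show "sorted_wrt (<) (map (row_pos D) [1..<num_rows D])"
    by (auto simp: sorted_wrt_iff_nth_less row_pos_strict_mono)
qed (auto simp: row_set_def)

end

text \<open>
  \<open>row_pos\<close> is strictly increasing, so its image is listed in increasing order by the
  rows; the number of elements gives the number of rows, and hence of columns, and the \<open>i\<close>-th element
  gives the length of row \<open>i\<close>.
\<close>

lemma shape_eq_if_row_set_eq:
  assumes "ferrers_diagram D m" "ferrers_diagram E m" and eq: "row_set D = row_set E"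
  shows "D = E"
proof -
  interpret D: ferrers_diagram D m by fact
  interpret E: ferrers_diagram E m by fact
  have "num_rows D - 1 = num_rows E - 1" using D.card_row_set E.card_row_set eq by simp
  then have rows: "num_rows D = num_rows E" using D.rows_cols E.rows_cols by linarith
  have cols: "num_cols D = num_cols E" using D.rows_cols E.rows_cols rows by linarith
  have "map (row_pos D) [1..<num_rows D] = map (row_pos E) [1..<num_rows D]"
    using D.map_row_pos E.map_row_pos eq rows by simp
  then have pos: "row_pos D i = row_pos E i" if "i \<in> {1..<num_rows D}" for i
    using that by (simp add: map_eq_conv)
  show ?thesis
  proof (rule nth_equalityI)
    show "length D = length E" using rows by (simp add: num_rows_def)
    fix i assume i: "i < length D"
    then have i': "i < num_rows D" "i < num_rows E" using rows by (simp_all add: num_rows_def)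
    show "D ! i = E ! i"
    proof (cases "i = 0")
      case True
      then show ?thesis using D.num_cols_nth E.num_cols_nth cols by simp
    next
      case False
      then show ?thesis
        using pos[of i] i' cols D.row_length_bounds[of i] E.row_length_bounds[of i]
        unfolding row_pos_def by auto
    qed
  qed
qed

lemma strict_sorted_nth_gap:
  fixes xs :: "nat list"
  assumes "sorted_wrt (<) xs" "i \<le> j" "j < length xs"
  shows "xs ! i + (j - i) \<le> xs ! j"
  using assms(2,3)
proof (induction j rule: dec_induct)
  case (step j)
  then have "xs ! j < xs ! Suc j" using assms(1) by (simp add: sorted_wrt_iff_nth_less)
  then show ?case using step by simp
qed simp

text \<open>
  The row lengths are forced by the equation that defines \<open>row_pos\<close>. They are positive and
  weakly decreasing because consecutive elements of a set of naturals differ by at least 1, both from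
  \<open>0\<close> upwards and from \<open>m - 1\<close> downwards.
\<close>

lemma ex_shape_with_row_set:
  assumes R: "R \<subseteq> {..<m}"
  obtains D where "ferrers_diagram D m" "row_set D = R"
proof -
  define xs where "xs = sorted_list_of_set R"
  have fin: "finite R" using R finite_subset by blast
  have sorted: "sorted_wrt (<) xs" and set: "set xs = R" and len: "length xs = card R"
    using fin by (simp_all add: xs_def)
  define k where "k = length xs"
  \<comment> \<open>The diagram has \<open>k + 1\<close> rows, so half-perimeter \<open>m + 2\<close> leaves \<open>q\<close> columns.\<close>
  define q where "q = m + 1 - k"
  have k: "k \<le> m" using card_mono[OF _ R] len by (simp add: k_def)
  have lower: "i \<le> xs ! i" if "i < k" for i
    using strict_sorted_nth_gap[OF sorted, of 0 i] that by (simp add: k_def)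
  have upper: "xs ! i < i + q" if "i < k" for i
  proof -
    have "xs ! i + (k - 1 - i) \<le> xs ! (k - 1)"
      using strict_sorted_nth_gap[OF sorted, of i "k - 1"] that by (simp add: k_def)
    moreover have "xs ! (k - 1) \<in> R" using set that nth_mem[of "k - 1" xs] by (simp add: k_def)
    then have "xs ! (k - 1) < m" using R by auto
    ultimately show ?thesis using that k by (simp add: q_def)
  qed
  define D where "D = q # map (\<lambda>i. i + q - xs ! i) [0..<k]"
  have rows: "num_rows D = k + 1" and cols: "num_cols D = q"
    by (simp_all add: D_def num_rows_def num_cols_def)
  have "sorted_wrt (\<ge>) (map (\<lambda>i. i + q - xs ! i) [0..<k])"
  proof (unfold sorted_wrt_iff_nth_less, intro allI impI)
    fix i j assume "i < j" "j < length (map (\<lambda>i. i + q - xs ! i) [0..<k])"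
    then show "map (\<lambda>i. i + q - xs ! i) [0..<k] ! i \<ge> map (\<lambda>i. i + q - xs ! i) [0..<k] ! j"
      using strict_sorted_nth_gap[OF sorted, of i j] by (simp add: k_def)
  qed
  moreover have "0 < q" using k by (simp add: q_def)
  ultimately have "ferrers D"
    using upper lower by (fastforce simp: ferrers_def D_def)
  moreover have "half_perimeter D = m + 2" using k by (simp add: half_perimeter_def rows cols q_def)
  ultimately have "ferrers_diagram D m" by unfold_locales
  moreover have "row_set D = R"
  proof -
    have "row_pos D (Suc i) = xs ! i" if "i < k" for i
      using that lower[of i] upper[of i] unfolding row_pos_def cols by (simp add: D_def)
    then have "row_pos D ` Suc ` {..<k} = (\<lambda>i. xs ! i) ` {..<k}"
      unfolding image_image by (intro image_cong) auto
    moreover have "{1..<num_rows D} = Suc ` {..<k}"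
      by (simp add: rows image_Suc_lessThan atLeastLessThanSuc_atLeastAtMost)
    moreover have "(\<lambda>i. xs ! i) ` {..<k} = R"
      using set by (auto simp: set_conv_nth k_def image_iff)
    ultimately show ?thesis by (simp add: row_set_def)
  qed
  ultimately show ?thesis by (rule that)
qed

section \<open>Staircase tableaux and tree-like tableaux, restated\<close>

lemma mem_staircase_tableaux_iff:
  "S \<in> staircase_tableaux m \<longleftrightarrow>
     (\<forall>r c. S (r, c) \<noteq> None \<longrightarrow> r + c < m) \<and>
     (\<forall>r c. S (r, c) \<noteq> Some LOne) \<and>
     (\<forall>r c. r + c + 1 = m \<longrightarrow> S (r, c) \<noteq> None) \<and>
     (\<forall>r c c'. S (r, c) \<in> beta_delta \<longrightarrow> c' < c \<longrightarrow> S (r, c') = None) \<and>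
     (\<forall>r c r'. S (r, c) \<in> alpha_gamma \<longrightarrow> r' < r \<longrightarrow> S (r', c) = None)"
proof -
  have nth: "staircase_shape m ! i = m - i" if "i < m" for i
    using that by (simp add: staircase_shape_def rev_nth del: upt_Suc)
  have rows: "num_rows (staircase_shape m) = m"
    by (simp add: staircase_shape_def num_rows_def del: upt_Suc)
  have boxes: "boxes (staircase_shape m) = {(r, c). r + c < m}"
    using nth rows by (auto simp: boxes_def num_rows_def)
  have "l \<in> {LAlpha, LBeta, LGamma, LDelta} \<longleftrightarrow> l \<noteq> LOne" for l by (cases l) simp_all
  then have ran: "ran S \<subseteq> {LAlpha, LBeta, LGamma, LDelta} \<longleftrightarrow> (\<forall>r c. S (r, c) \<noteq> Some LOne)"
    unfolding subset_iff ran_def mem_Collect_eq by (metis surj_pair)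
  have dom: "dom S \<subseteq> boxes (staircase_shape m) \<longleftrightarrow> (\<forall>r c. S (r, c) \<noteq> None \<longrightarrow> r + c < m)"
    by (auto simp: boxes dom_def)
  have diag: "(\<forall>i < m. S (i, staircase_shape m ! i - 1) \<noteq> None)
      \<longleftrightarrow> (\<forall>r c. r + c + 1 = m \<longrightarrow> S (r, c) \<noteq> None)" (is "?L \<longleftrightarrow> ?R")
  proof
    assume L: ?L
    show ?R
    proof (intro allI impI)
      fix r c assume "r + c + 1 = m"
      then have "r < m" "staircase_shape m ! r - 1 = c" using nth[of r] by auto
      then show "S (r, c) \<noteq> None" using L by auto
    qed
  next
    assume ?R
    then show ?L using nth by auto
  qed
  have beta: "(\<forall>c \<in> boxes (staircase_shape m). S c \<in> beta_delta \<longrightarrow>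
        (\<forall>b \<in> left_of (staircase_shape m) c. S b = None)) \<longleftrightarrow>
      (\<forall>r c c'. S (r, c) \<in> beta_delta \<longrightarrow> c' < c \<longrightarrow> S (r, c') = None)" (is "?L \<longleftrightarrow> ?R")
    if dom: "\<forall>r c. S (r, c) \<noteq> None \<longrightarrow> r + c < m"
  proof
    assume L: ?L
    show ?R
    proof (intro allI impI)
      fix r c c' assume rc: "S (r, c) \<in> beta_delta" and less: "c' < c"
      have "S (r, c) \<noteq> None" using rc by auto
      then have "r + c < m" using dom by blast
      then have "(r, c) \<in> boxes (staircase_shape m)" "(r, c') \<in> left_of (staircase_shape m) (r, c)"
        using less by (simp_all add: boxes left_of_def)
      then show "S (r, c') = None" using L rc by blast
    qed
  next
    assume R: ?R
    show ?L
    proof (intro ballI impI)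
      fix x b assume x: "S x \<in> beta_delta" and "b \<in> left_of (staircase_shape m) x"
      then obtain r c c' where "x = (r, c)" "b = (r, c')" "c' < c"
        by (cases x) (auto simp: left_of_eq)
      then show "S b = None" using R x by metis
    qed
  qed
  have alpha: "(\<forall>c \<in> boxes (staircase_shape m). S c \<in> alpha_gamma \<longrightarrow>
        (\<forall>b \<in> above (staircase_shape m) c. S b = None)) \<longleftrightarrow>
      (\<forall>r c r'. S (r, c) \<in> alpha_gamma \<longrightarrow> r' < r \<longrightarrow> S (r', c) = None)" (is "?L \<longleftrightarrow> ?R")
    if dom: "\<forall>r c. S (r, c) \<noteq> None \<longrightarrow> r + c < m"
  proof
    assume L: ?L
    show ?R
    proof (intro allI impI)
      fix r c r' assume rc: "S (r, c) \<in> alpha_gamma" and less: "r' < r"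
      have "S (r, c) \<noteq> None" using rc by auto
      then have "r + c < m" using dom by blast
      then have "(r, c) \<in> boxes (staircase_shape m)" "(r', c) \<in> above (staircase_shape m) (r, c)"
        using less by (simp_all add: boxes above_def)
      then show "S (r', c) = None" using L rc by blast
    qed
  next
    assume R: ?R
    show ?L
    proof (intro ballI impI)
      fix x b assume x: "S x \<in> alpha_gamma" and "b \<in> above (staircase_shape m) x"
      then obtain r c r' where "x = (r, c)" "b = (r', c)" "r' < r"
        by (cases x) (auto simp: above_eq)
      then show "S b = None" using R x by metis
    qed
  qed
  show ?thesis
    unfolding staircase_tableaux_def mem_Collect_eq Let_def rows dom ran diag
      alpha_gamma_def[symmetric] beta_delta_def[symmetric]
    by (intro conj_cong refl beta alpha)
qed

lemma staircase_tableauD [rule_format]: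
  assumes "S \<in> staircase_tableaux m"
  shows "\<forall>r c. S (r, c) \<noteq> None \<longrightarrow> r + c < m"
    and "\<forall>r c. S (r, c) \<noteq> Some LOne"
    and "\<forall>r c. r + c + 1 = m \<longrightarrow> S (r, c) \<noteq> None"
    and "\<forall>r c c'. S (r, c) \<in> beta_delta \<longrightarrow> c' < c \<longrightarrow> S (r, c') = None"
    and "\<forall>r c r'. S (r, c) \<in> alpha_gamma \<longrightarrow> r' < r \<longrightarrow> S (r', c) = None"
  using assms unfolding mem_staircase_tableaux_iff by - (elim conjE, assumption)+

text \<open>
  The labels that the remaining boxes of a column or row force upon its first box. For \<open>j = 0\<close> or
  \<open>i = 0\<close> they yield the label 1 of the root box, since the first column and row carry only 1s.
\<close>

definition first_row_label :: "nat list \<Rightarrow> filling \<Rightarrow> nat \<Rightarrow> label option" where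
  "first_row_label D T j =
     (if j < num_cols D \<and> (\<forall>i. T (i, j) \<notin> alpha_gamma) then Some LOne else None)"

definition first_col_label :: "nat list \<Rightarrow> filling \<Rightarrow> nat \<Rightarrow> label option" where
  "first_col_label D T i =
     (if i < num_rows D \<and> (\<forall>j. T (i, j) \<notin> beta_delta) then Some LOne else None)"

text \<open>
  A filling is empty outside its diagram, so the quantifiers need not be bounded by boxes.
\<close>

lemma mem_labeled_tree_like_tableaux_iff_filling:
  "X \<in> labeled_tree_like_tableaux (Suc m) \<longleftrightarrow>
     (let D = shape X; T = box_label X; V = vedge_label X; H = hedge_label X in
     ferrers_diagram D m \<and> dom T \<subseteq> boxes D \<and>
     dom V = {..<num_rows D} \<and> dom H = {..<num_cols D} \<and>
     V 0 = Some LOne \<and> H 0 = Some LOne \<and>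
     (\<forall>i\<in>{1..<num_rows D}. V i \<in> alpha_gamma) \<and>
     (\<forall>j\<in>{1..<num_cols D}. H j \<in> beta_delta) \<and>
     T (0, 0) = Some LOne \<and>
     (\<forall>i j l. T (i, j) = Some l \<longrightarrow> (l = LOne \<longleftrightarrow> i = 0 \<or> j = 0)) \<and>
     (\<forall>i < num_rows D. \<exists>j. T (i, j) \<noteq> None) \<and>
     (\<forall>j < num_cols D. \<exists>i. T (i, j) \<noteq> None) \<and>
     (\<forall>i j. T (i, j) \<in> alpha_gamma \<longrightarrow>
        (\<forall>i'<i. T (i', j) = None) \<and> (\<exists>j'<j. T (i, j') \<noteq> None)) \<and>
     (\<forall>i j. T (i, j) \<in> beta_delta \<longrightarrow>
        (\<forall>j'<j. T (i, j') = None) \<and> (\<exists>i'<i. T (i', j) \<noteq> None)))"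
proof -
  define D where "D = shape X"
  define T where "T = box_label X"
  have diagram: "ferrers_diagram D m \<longleftrightarrow> ferrers D \<and> half_perimeter D = Suc m + 1"
    by (simp add: ferrers_diagram_def)
  have V: "(\<forall>i. 0 < i \<and> i < p \<longrightarrow> V i \<in> L) \<longleftrightarrow> (\<forall>i\<in>{1..<p}. V i \<in> L)"
    for p and V :: "nat \<Rightarrow> label option" and L
    by (auto simp: Suc_le_eq)
  have in_boxes: "T c \<noteq> None \<Longrightarrow> c \<in> boxes D" if "dom T \<subseteq> boxes D" for c
    using that by (auto simp: dom_def)
  have not_in_boxes: "T c = None" if "dom T \<subseteq> boxes D" "c \<notin> boxes D" for c
    using that by (auto simp: dom_def)
  have ball_boxes: "(\<forall>c \<in> boxes D. T c \<in> L \<longrightarrow> P c) \<longleftrightarrow>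
      (\<forall>i j. T (i, j) \<in> L \<longrightarrow> P (i, j))" if "dom T \<subseteq> boxes D" "None \<notin> L" for L P
  proof
    assume P: "\<forall>c \<in> boxes D. T c \<in> L \<longrightarrow> P c"
    show "\<forall>i j. T (i, j) \<in> L \<longrightarrow> P (i, j)"
    proof (intro allI impI)
      fix i j assume "T (i, j) \<in> L"
      moreover from this have "(i, j) \<in> boxes D" using that(2) by (intro in_boxes[OF that(1)]) metis
      ultimately show "P (i, j)" using P by blast
    qed
  qed auto
  have rows: "(\<forall>i < num_rows D. \<exists>j. (i, j) \<in> boxes D \<and> T (i, j) \<noteq> None) \<longleftrightarrow>
      (\<forall>i < num_rows D. \<exists>j. T (i, j) \<noteq> None)" if "dom T \<subseteq> boxes D"
    using in_boxes[OF that] by blast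
  have cols: "(\<forall>j < num_cols D. \<exists>i. (i, j) \<in> boxes D \<and> T (i, j) \<noteq> None) \<longleftrightarrow>
      (\<forall>j < num_cols D. \<exists>i. T (i, j) \<noteq> None)" if "dom T \<subseteq> boxes D"
    using in_boxes[OF that] by blast
  have above_None: "(\<forall>b \<in> above D (i, j). T b = None) \<longleftrightarrow> (\<forall>i'<i. T (i', j) = None)"
    if "dom T \<subseteq> boxes D" for i j
  proof -
    have "(\<forall>b \<in> above D (i, j). T b = None) \<longleftrightarrow> (\<forall>i'. i' < i \<and> (i', j) \<in> boxes D \<longrightarrow> T (i', j) = None)"
      unfolding above_eq by fast
    then show ?thesis using not_in_boxes[OF that] by meson
  qed
  have above_Some: "(\<exists>b \<in> above D (i, j). T b \<noteq> None) \<longleftrightarrow> (\<exists>i'<i. T (i', j) \<noteq> None)"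
    if "dom T \<subseteq> boxes D" for i j
    using above_None[OF that, of i j] by meson
  have left_None: "(\<forall>b \<in> left_of D (i, j). T b = None) \<longleftrightarrow> (\<forall>j'<j. T (i, j') = None)"
    if "dom T \<subseteq> boxes D" for i j
  proof -
    have "(\<forall>b \<in> left_of D (i, j). T b = None) \<longleftrightarrow> (\<forall>j'. j' < j \<and> (i, j') \<in> boxes D \<longrightarrow> T (i, j') = None)"
      unfolding left_of_eq by fast
    then show ?thesis using not_in_boxes[OF that] by meson
  qed
  have left_Some: "(\<exists>b \<in> left_of D (i, j). T b \<noteq> None) \<longleftrightarrow> (\<exists>j'<j. T (i, j') \<noteq> None)"
    if "dom T \<subseteq> boxes D" for i j
    using left_None[OF that, of i j] by meson
  have alpha: "(\<forall>c \<in> boxes D. T c \<in> alpha_gamma \<longrightarrow>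
        (\<forall>b \<in> above D c. T b = None) \<and> (\<exists>b \<in> left_of D c. T b \<noteq> None)) \<longleftrightarrow>
      (\<forall>i j. T (i, j) \<in> alpha_gamma \<longrightarrow>
        (\<forall>i'<i. T (i', j) = None) \<and> (\<exists>j'<j. T (i, j') \<noteq> None))" if "dom T \<subseteq> boxes D"
    by (simp only: ball_boxes[OF that] above_None[OF that] left_Some[OF that] alpha_gamma_beta_delta_simps
        not_False_eq_True)
  have beta: "(\<forall>c \<in> boxes D. T c \<in> beta_delta \<longrightarrow>
        (\<forall>b \<in> left_of D c. T b = None) \<and> (\<exists>b \<in> above D c. T b \<noteq> None)) \<longleftrightarrow>
      (\<forall>i j. T (i, j) \<in> beta_delta \<longrightarrow>
        (\<forall>j'<j. T (i, j') = None) \<and> (\<exists>i'<i. T (i', j) \<noteq> None))" if "dom T \<subseteq> boxes D"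
    by (simp only: ball_boxes[OF that] above_Some[OF that] left_None[OF that] alpha_gamma_beta_delta_simps
        not_False_eq_True)
  show ?thesis
  proof (cases "dom T \<subseteq> boxes D")
    case True
    show ?thesis
      unfolding labeled_tree_like_tableaux_def mem_Collect_eq Let_def V
        alpha_gamma_def[symmetric] beta_delta_def[symmetric]
        D_def[symmetric] T_def[symmetric] diagram rows[OF True] cols[OF True] alpha[OF True] beta[OF True]
      by (intro iffI; elim conjE; intro conjI; assumption)
  next
    case False
    then show ?thesis
      unfolding labeled_tree_like_tableaux_def mem_Collect_eq Let_def D_def[symmetric] T_def[symmetric]
      by simp
  qed
qed

lemma border_label_cases:
  "first_row_label D T j = None \<or> first_row_label D T j = Some LOne"
  "first_col_label D T i = None \<or> first_col_label D T i = Some LOne"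
  by (simp_all add: first_row_label_def first_col_label_def)

text \<open>
  Left to right, an \<open>\<alpha>\<close> or \<open>\<gamma>\<close> is always topmost in its column. The topmost labeled box of a column is not \<open>\<beta>\<close> or \<open>\<delta>\<close>, since these
  have a labeled box above them; so it is \<open>\<alpha>\<close> or \<open>\<gamma>\<close>, and then the first box is
  empty, or it is the first box. Right to left, an \<open>\<alpha>\<close> or \<open>\<gamma>\<close> needs a labeled box
  to its left: either the first box of its row is one, or the row was denied a 1 because
  it contains a \<open>\<beta>\<close> or \<open>\<delta>\<close>, which must stand to the left because it empties
  everything on its own left. Columns are symmetric.
\<close>

lemma mem_labeled_tree_like_tableaux_iff:
  "X \<in> labeled_tree_like_tableaux (Suc m) \<longleftrightarrow>
     (let D = shape X; T = box_label X; V = vedge_label X; H = hedge_label X in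
     ferrers_diagram D m \<and> dom T \<subseteq> boxes D \<and>
     dom V = {..<num_rows D} \<and> dom H = {..<num_cols D} \<and>
     V 0 = Some LOne \<and> H 0 = Some LOne \<and>
     (\<forall>i\<in>{1..<num_rows D}. V i \<in> alpha_gamma) \<and>
     (\<forall>j\<in>{1..<num_cols D}. H j \<in> beta_delta) \<and>
     (\<forall>j. T (0, j) = first_row_label D T j) \<and>
     (\<forall>i. T (i, 0) = first_col_label D T i) \<and>
     (\<forall>i j. 0 < i \<longrightarrow> 0 < j \<longrightarrow> T (i, j) \<noteq> Some LOne) \<and>
     (\<forall>i j i'. T (i, j) \<in> alpha_gamma \<longrightarrow> 0 < i' \<longrightarrow> i' < i \<longrightarrow> T (i', j) = None) \<and>
     (\<forall>i j j'. T (i, j) \<in> beta_delta \<longrightarrow> 0 < j' \<longrightarrow> j' < j \<longrightarrow> T (i, j') = None))"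
proof -
  define D where "D = shape X"
  define T where "T = box_label X"
  have first_row_col: "T (0, 0) = Some LOne \<and>
     (\<forall>i j l. T (i, j) = Some l \<longrightarrow> (l = LOne \<longleftrightarrow> i = 0 \<or> j = 0)) \<and>
     (\<forall>i < num_rows D. \<exists>j. T (i, j) \<noteq> None) \<and>
     (\<forall>j < num_cols D. \<exists>i. T (i, j) \<noteq> None) \<and>
     (\<forall>i j. T (i, j) \<in> alpha_gamma \<longrightarrow>
        (\<forall>i'<i. T (i', j) = None) \<and> (\<exists>j'<j. T (i, j') \<noteq> None)) \<and>
     (\<forall>i j. T (i, j) \<in> beta_delta \<longrightarrow>
        (\<forall>j'<j. T (i, j') = None) \<and> (\<exists>i'<i. T (i', j) \<noteq> None)) \<longleftrightarrow>
     (\<forall>j. T (0, j) = first_row_label D T j) \<and>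
     (\<forall>i. T (i, 0) = first_col_label D T i) \<and>
     (\<forall>i j. 0 < i \<longrightarrow> 0 < j \<longrightarrow> T (i, j) \<noteq> Some LOne) \<and>
     (\<forall>i j i'. T (i, j) \<in> alpha_gamma \<longrightarrow> 0 < i' \<longrightarrow> i' < i \<longrightarrow> T (i', j) = None) \<and>
     (\<forall>i j j'. T (i, j) \<in> beta_delta \<longrightarrow> 0 < j' \<longrightarrow> j' < j \<longrightarrow> T (i, j') = None)"
    (is "?L \<longleftrightarrow> ?R") if D: "ferrers_diagram D m" and dom: "dom T \<subseteq> boxes D"
  proof
    interpret ferrers_diagram D m by (rule D)
    have bounds: "i < num_rows D" "j < num_cols D" if "T (i, j) \<noteq> None" for i j
      using mem_boxesD[OF subsetD[OF dom domI]] that by blast+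
    {
      assume L: ?L
      note root = L[THEN conjunct1] and rest = L[THEN conjunct2]
      note one = rest[THEN conjunct1, rule_format] and rest = rest[THEN conjunct2]
      note rows = rest[THEN conjunct1, rule_format] and rest = rest[THEN conjunct2]
      note cols = rest[THEN conjunct1, rule_format] and rest = rest[THEN conjunct2]
      note alpha = rest[THEN conjunct1, rule_format] and beta = rest[THEN conjunct2, rule_format]
      have border: "T (i, j) = Some LOne" if "T (i, j) \<noteq> None" "i = 0 \<or> j = 0" for i j
        using that one by auto
      have inner: "T (i, j) \<in> alpha_gamma \<or> T (i, j) \<in> beta_delta"
        if "T (i, j) \<noteq> None" "0 < i" "0 < j" for i j
        using that one[of i j LOne] label_cases[of "T (i, j)"] by auto
      have row_eq: "T (0, j) = first_row_label D T j" for j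
      proof (cases "j < num_cols D \<and> (\<forall>i. T (i, j) \<notin> alpha_gamma)")
        case True
        define i where "i = (LEAST i. T (i, j) \<noteq> None)"
        have i: "T (i, j) \<noteq> None" using cols True unfolding i_def by (metis (mono_tags, lifting) LeastI)
        have least: "T (i', j) = None" if "i' < i" for i'
          using that not_less_Least unfolding i_def by metis
        have "i = 0"
        proof (rule ccontr)
          assume "i \<noteq> 0"
          then have "0 < i" "0 < j" using least[of 0] root by (auto intro: gr0I)
          then have "T (i, j) \<in> beta_delta" using inner i True by blast
          from beta[OF this] have "\<exists>i'<i. T (i', j) \<noteq> None" ..
          then show False using least by metis
        qed
        then show ?thesis using True border i by (simp add: first_row_label_def)
      next
        case False
        have "T (0, j) = None"
        proof (rule ccontr)
          assume nonempty: "T (0, j) \<noteq> None"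
          then obtain i where i: "T (i, j) \<in> alpha_gamma" using False bounds(2)[OF nonempty] by blast
          then have "i \<noteq> 0" using border[OF nonempty] by (intro notI) simp
          then show False using alpha[OF i] nonempty by simp
        qed
        then show ?thesis using False by (auto simp: first_row_label_def)
      qed
      have col_eq: "T (i, 0) = first_col_label D T i" for i
      proof (cases "i < num_rows D \<and> (\<forall>j. T (i, j) \<notin> beta_delta)")
        case True
        define j where "j = (LEAST j. T (i, j) \<noteq> None)"
        have j: "T (i, j) \<noteq> None" using rows True unfolding j_def by (metis (mono_tags, lifting) LeastI)
        have least: "T (i, j') = None" if "j' < j" for j'
          using that not_less_Least unfolding j_def by metis
        have "j = 0"
        proof (rule ccontr)
          assume "j \<noteq> 0"
          then have "0 < j" "0 < i" using least[of 0] root by (auto intro: gr0I)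
          then have "T (i, j) \<in> alpha_gamma" using inner j True by blast
          from alpha[OF this] have "\<exists>j'<j. T (i, j') \<noteq> None" ..
          then show False using least by metis
        qed
        then show ?thesis using True border j by (simp add: first_col_label_def)
      next
        case False
        have "T (i, 0) = None"
        proof (rule ccontr)
          assume nonempty: "T (i, 0) \<noteq> None"
          then obtain j where j: "T (i, j) \<in> beta_delta" using False bounds(1)[OF nonempty] by blast
          then have "j \<noteq> 0" using border[OF nonempty] by (intro notI) simp
          then show False using beta[OF j] nonempty by simp
        qed
        then show ?thesis using False by (auto simp: first_col_label_def)
      qed
      have not_one: "T (i, j) \<noteq> Some LOne" if "0 < i" "0 < j" for i j
        using one[of i j] that by auto
      have alpha': "T (i', j) = None" if "T (i, j) \<in> alpha_gamma" "i' < i" for i j i'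
        using alpha[OF that(1)] that(2) by simp
      have beta': "T (i, j') = None" if "T (i, j) \<in> beta_delta" "j' < j" for i j j'
        using beta[OF that(1)] that(2) by simp
      show ?R
        by (intro conjI allI impI)
          (fact row_eq col_eq | erule (1) not_one | erule (1) alpha' | erule (1) beta')+
    next
      assume R: ?R
      note row = R[THEN conjunct1, rule_format] and rest = R[THEN conjunct2]
      note col = rest[THEN conjunct1, rule_format] and rest = rest[THEN conjunct2]
      note inner = rest[THEN conjunct1, rule_format] and rest = rest[THEN conjunct2]
      note alpha = rest[THEN conjunct1, rule_format] and beta = rest[THEN conjunct2, rule_format]
      have border: "T (i, j) = None \<or> T (i, j) = Some LOne" if "i = 0 \<or> j = 0" for i j
        using that row[of j] col[of i] border_label_cases[of D T] by metis
      have row_None: "T (0, j) = None \<longleftrightarrow> (\<exists>i. T (i, j) \<in> alpha_gamma)" if "j < num_cols D" for j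
        using row[of j] that by (simp add: first_row_label_def)
      have col_None: "T (i, 0) = None \<longleftrightarrow> (\<exists>j. T (i, j) \<in> beta_delta)" if "i < num_rows D" for i
        using col[of i] that by (simp add: first_col_label_def)
      have root: "T (0, 0) = Some LOne"
      proof (rule ccontr)
        assume "T (0, 0) \<noteq> Some LOne"
        then have "T (0, 0) = None" using border[of 0 0] by simp
        then obtain i where "T (i, 0) \<in> alpha_gamma" using row_None[of 0] rows_cols by auto
        then show False using border[of i 0] by auto
      qed
      have one: "l = LOne \<longleftrightarrow> i = 0 \<or> j = 0" if "T (i, j) = Some l" for i j l
        using that border[of i j] inner[of i j] by auto
      have rows: "\<exists>j. T (i, j) \<noteq> None" if "i < num_rows D" for i
        using col_None[OF that] alpha_gamma_beta_delta_simps(3) by metis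
      have cols: "\<exists>i. T (i, j) \<noteq> None" if "j < num_cols D" for j
        using row_None[OF that] alpha_gamma_beta_delta_simps(1) by metis
      have alpha': "(\<forall>i'<i. T (i', j) = None) \<and> (\<exists>j'<j. T (i, j') \<noteq> None)"
        if ij: "T (i, j) \<in> alpha_gamma" for i j
      proof
        have b: "i < num_rows D" "j < num_cols D" using bounds[of i j] ij by auto
        have "T (0, j) = None" using row_None[OF b(2)] ij by blast
        then show "\<forall>i'<i. T (i', j) = None" using alpha[OF ij] by (metis gr0I)
        have "0 < j" using border[of i j] ij by (intro gr0I) simp
        show "\<exists>j'<j. T (i, j') \<noteq> None"
        proof (cases "T (i, 0) = None")
          case True
          then obtain j' where j': "T (i, j') \<in> beta_delta" using col_None[OF b(1)] by metis
          then have "\<not> j < j'" using beta[OF j' \<open>0 < j\<close>] ij by auto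
          moreover have "j \<noteq> j'" using j' ij by auto
          ultimately show ?thesis using j' by (intro exI[of _ j']) auto
        qed (use \<open>0 < j\<close> in metis)
      qed
      have beta': "(\<forall>j'<j. T (i, j') = None) \<and> (\<exists>i'<i. T (i', j) \<noteq> None)"
        if ij: "T (i, j) \<in> beta_delta" for i j
      proof
        have b: "i < num_rows D" "j < num_cols D" using bounds[of i j] ij by auto
        have "T (i, 0) = None" using col_None[OF b(1)] ij by blast
        then show "\<forall>j'<j. T (i, j') = None" using beta[OF ij] by (metis gr0I)
        have "0 < i" using border[of i j] ij by (intro gr0I) simp
        show "\<exists>i'<i. T (i', j) \<noteq> None"
        proof (cases "T (0, j) = None")
          case True
          then obtain i' where i': "T (i', j) \<in> alpha_gamma" using row_None[OF b(2)] by metis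
          then have "\<not> i < i'" using alpha[OF i' \<open>0 < i\<close>] ij by auto
          moreover have "i \<noteq> i'" using i' ij by auto
          ultimately show ?thesis using i' by (intro exI[of _ i']) auto
        qed (use \<open>0 < i\<close> in metis)
      qed
      show ?L by (intro conjI allI impI root one rows cols alpha' beta')
    }
  qed
  show ?thesis
    unfolding mem_labeled_tree_like_tableaux_iff_filling Let_def D_def[symmetric] T_def[symmetric]
    by (intro conj_cong refl first_row_col)
qed

lemma labeled_tree_like_tableauD [rule_format]:
  assumes "X \<in> labeled_tree_like_tableaux (Suc m)"
  shows "ferrers_diagram (shape X) m"
    and "dom (box_label X) \<subseteq> boxes (shape X)"
    and "dom (vedge_label X) = {..<num_rows (shape X)}"
    and "dom (hedge_label X) = {..<num_cols (shape X)}"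
    and "vedge_label X 0 = Some LOne"
    and "hedge_label X 0 = Some LOne"
    and "\<forall>i\<in>{1..<num_rows (shape X)}. vedge_label X i \<in> alpha_gamma"
    and "\<forall>j\<in>{1..<num_cols (shape X)}. hedge_label X j \<in> beta_delta"
    and "\<forall>j. box_label X (0, j) = first_row_label (shape X) (box_label X) j"
    and "\<forall>i. box_label X (i, 0) = first_col_label (shape X) (box_label X) i"
    and "\<forall>i j. 0 < i \<longrightarrow> 0 < j \<longrightarrow> box_label X (i, j) \<noteq> Some LOne"
    and "\<forall>i j i'. box_label X (i, j) \<in> alpha_gamma \<longrightarrow> 0 < i' \<longrightarrow> i' < i \<longrightarrow>
      box_label X (i', j) = None"
    and "\<forall>i j j'. box_label X (i, j) \<in> beta_delta \<longrightarrow> 0 < j' \<longrightarrow> j' < j \<longrightarrow>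
      box_label X (i, j') = None"
  using assms unfolding mem_labeled_tree_like_tableaux_iff Let_def by - (elim conjE, assumption)+

section \<open>The bijection\<close>

text \<open>
  The inverses undo \<open>row_pos\<close> and \<open>col_pos\<close>. The first case may ask for the label of a
  pair outside the diagram, which is \<open>None\<close>; by \<open>pos_sum_cases\<close> such a pair is sent
  below the diagonal. A diagonal box never falls under the first case.
\<close>

definition to_staircase :: "nat \<Rightarrow> ltlt \<Rightarrow> filling" where
  "to_staircase m X = (\<lambda>(r, c).
     let D = shape X;
         i = inv_into {1..<num_rows D} (row_pos D) r;
         j = inv_into {1..<num_cols D} (col_pos D) c
     in if r \<in> row_set D \<and> c \<in> col_set D then box_label X (i, j)
        else if r + c + 1 \<noteq> m then None
        else if r \<in> row_set D then vedge_label X i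
        else hedge_label X j)"

context ferrers_diagram
begin

lemma to_staircase_box:
  "shape X = D \<Longrightarrow> i \<in> {1..<num_rows D} \<Longrightarrow> j \<in> {1..<num_cols D} \<Longrightarrow>
   to_staircase m X (row_pos D i, col_pos D j) = box_label X (i, j)"
  using inv_into_f_f[OF row_pos_inj, of i] inv_into_f_f[OF col_pos_inj, of j]
  by (simp add: to_staircase_def row_set_def col_set_def)

lemma to_staircase_vedge:
  "shape X = D \<Longrightarrow> i \<in> {1..<num_rows D} \<Longrightarrow> row_pos D i + c + 1 = m \<Longrightarrow>
   to_staircase m X (row_pos D i, c) = vedge_label X i"
  using mem_col_set_iff[of "row_pos D i" c] inv_into_f_f[OF row_pos_inj, of i]
  by (simp add: to_staircase_def row_set_def)

lemma to_staircase_hedge: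
  "shape X = D \<Longrightarrow> j \<in> {1..<num_cols D} \<Longrightarrow> r + col_pos D j + 1 = m \<Longrightarrow>
   to_staircase m X (r, col_pos D j) = hedge_label X j"
  using mem_col_set_iff[of r "col_pos D j"] inv_into_f_f[OF col_pos_inj, of j]
  by (simp add: to_staircase_def col_set_def)

lemma to_staircase_None:
  "shape X = D \<Longrightarrow> r + c + 1 \<noteq> m \<Longrightarrow> \<not> (r \<in> row_set D \<and> c \<in> col_set D) \<Longrightarrow>
   to_staircase m X (r, c) = None"
  by (auto simp: to_staircase_def Let_def)

lemma cell_cases:
  obtains (box) i j where "i \<in> {1..<num_rows D}" "j \<in> {1..<num_cols D}"
      "r = row_pos D i" "c = col_pos D j" "r + c + 1 \<noteq> m"
  | (vedge) i where "i \<in> {1..<num_rows D}" "r = row_pos D i" "r + c + 1 = m" "c \<notin> col_set D"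
  | (hedge) j where "j \<in> {1..<num_cols D}" "c = col_pos D j" "r + c + 1 = m" "r \<notin> row_set D"
  | (outside) "r + c + 1 \<noteq> m" "\<not> (r \<in> row_set D \<and> c \<in> col_set D)"
proof (cases "r + c + 1 = m")
  case True
  show ?thesis
  proof (cases "r \<in> row_set D")
    case row: True
    then show ?thesis using vedge True mem_col_set_iff[OF True] by (auto simp: row_set_def)
  next
    case False
    then have "c \<in> col_set D" using mem_col_set_iff[OF True] by blast
    then show ?thesis using hedge True False by (auto simp: col_set_def)
  qed
next
  case False
  then show ?thesis using box outside by (cases "r \<in> row_set D \<and> c \<in> col_set D") (auto simp: row_set_def col_set_def)
qed

end

text \<open>
  The emptiness conditions transfer because \<open>row_pos\<close> and \<open>col_pos\<close> are monotone. On the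
  diagonal they hold because the row of a \<open>\<beta>\<close> or \<open>\<delta>\<close> edge label lies outside
  \<open>row_set\<close>, so nothing else is put there, and dually for columns.
\<close>

lemma to_staircase_in_staircase_tableaux:
  assumes X: "X \<in> labeled_tree_like_tableaux (Suc m)"
  shows "to_staircase m X \<in> staircase_tableaux m"
proof -
  define D where "D = shape X"
  define T where "T = box_label X"
  define S where "S = to_staircase m X"
  note ltlt = labeled_tree_like_tableauD[OF X, folded D_def T_def]
  interpret ferrers_diagram D m by (rule ltlt(1))
  have box_eq: "S (r, c) = T (i, j)"
    if "i \<in> {1..<num_rows D}" "j \<in> {1..<num_cols D}" "r = row_pos D i" "c = col_pos D j" for r c i j
    using to_staircase_box[OF D_def[symmetric], of i j] that by (simp add: S_def T_def)
  have vedge_alpha: "S (r, c) \<in> alpha_gamma"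
    if "i \<in> {1..<num_rows D}" "r = row_pos D i" "r + c + 1 = m" for r c i
    using to_staircase_vedge[OF D_def[symmetric], of i c] ltlt(7)[of i] that by (simp add: S_def)
  have hedge_beta: "S (r, c) \<in> beta_delta"
    if "j \<in> {1..<num_cols D}" "c = col_pos D j" "r + c + 1 = m" for r c j
    using to_staircase_hedge[OF D_def[symmetric], of j r] ltlt(8)[of j] that by (simp add: S_def)
  have outside_None: "S (r, c) = None"
    if "r + c + 1 \<noteq> m" "\<not> (r \<in> row_set D \<and> c \<in> col_set D)" for r c
    using to_staircase_None[OF D_def[symmetric] that] by (simp add: S_def)
  have inside: "r + c < m" if rc: "S (r, c) \<noteq> None" for r c
  proof (cases r c rule: cell_cases)
    case (box i j)
    then have "T (i, j) \<noteq> None" using box_eq rc by metis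
    then have "(i, j) \<in> boxes D" using ltlt(2) by (metis domIff subsetD)
    then show ?thesis using pos_sum_cases[of i j] box by simp
  next
    case outside
    then show ?thesis using rc outside_None by metis
  qed simp_all
  have not_one: "S (r, c) \<noteq> Some LOne" for r c
  proof (cases r c rule: cell_cases)
    case (box i j)
    then have "T (i, j) \<noteq> Some LOne" using ltlt(11)[of i j] by simp
    then show ?thesis using box_eq[OF box(1-4)] by simp
  next
    case (vedge i)
    then have "S (r, c) \<in> alpha_gamma" by (intro vedge_alpha)
    then show ?thesis by (intro notI) simp
  next
    case (hedge j)
    then have "S (r, c) \<in> beta_delta" by (intro hedge_beta)
    then show ?thesis by (intro notI) simp
  next
    case outside
    then show ?thesis using outside_None by simp
  qed
  have diag: "S (r, c) \<noteq> None" if "r + c + 1 = m" for r c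
  proof (cases r c rule: cell_cases)
    case (vedge i)
    then have "S (r, c) \<in> alpha_gamma" by (intro vedge_alpha)
    then show ?thesis by simp
  next
    case (hedge j)
    then have "S (r, c) \<in> beta_delta" by (intro hedge_beta)
    then show ?thesis by simp
  qed (use that in simp_all)
  have left: "S (r, c') = None" if rc: "S (r, c) \<in> beta_delta" and less: "c' < c" for r c c'
  proof -
    have "r + c < m" using rc by (intro inside) simp
    then have off_diag: "r + c' + 1 \<noteq> m" using less by simp
    show ?thesis
    proof (cases r c rule: cell_cases)
      case (box i j)
      then have ij: "T (i, j) \<in> beta_delta" using rc box_eq[OF box(1-4)] by simp
      show ?thesis
      proof (cases "c' \<in> col_set D")
        case True
        then obtain j' where j': "j' \<in> {1..<num_cols D}" "c' = col_pos D j'"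
          by (auto simp: col_set_def)
        then have "j' < j" using col_pos_less_iff[of j' j] box less by simp
        then have "T (i, j') = None" using ltlt(13)[OF ij, of j'] j' by simp
        then show ?thesis using box_eq[OF box(1) j'(1) box(3) j'(2)] by simp
      qed (use outside_None off_diag in simp)
    next
      case (vedge i)
      then have "S (r, c) \<in> alpha_gamma" by (intro vedge_alpha)
      then show ?thesis using rc by simp
    next
      case (hedge j)
      then show ?thesis using outside_None off_diag by simp
    next
      case outside
      then show ?thesis using outside_None rc by simp
    qed
  qed
  have up: "S (r', c) = None" if rc: "S (r, c) \<in> alpha_gamma" and less: "r' < r" for r c r'
  proof -
    have "r + c < m" using rc by (intro inside) simp
    then have off_diag: "r' + c + 1 \<noteq> m" using less by simp
    show ?thesis
    proof (cases r c rule: cell_cases)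
      case (box i j)
      then have ij: "T (i, j) \<in> alpha_gamma" using rc box_eq[OF box(1-4)] by simp
      show ?thesis
      proof (cases "r' \<in> row_set D")
        case True
        then obtain i' where i': "i' \<in> {1..<num_rows D}" "r' = row_pos D i'"
          by (auto simp: row_set_def)
        then have "i' < i" using row_pos_less_iff[of i' i] box less by simp
        then have "T (i', j) = None" using ltlt(12)[OF ij, of i'] i' by simp
        then show ?thesis using box_eq[OF i'(1) box(2) i'(2) box(4)] by simp
      qed (use outside_None off_diag in simp)
    next
      case (vedge i)
      then show ?thesis using outside_None off_diag by simp
    next
      case (hedge j)
      then have "S (r, c) \<in> beta_delta" by (intro hedge_beta)
      then show ?thesis using rc by simp
    next
      case outside
      then show ?thesis using outside_None rc by simp
    qed
  qed
  show ?thesis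
    unfolding mem_staircase_tableaux_iff S_def[symmetric]
    by (intro conjI allI impI)
      (erule inside | rule not_one | erule diag | erule (1) left | erule (1) up)+
qed

text \<open>
  Recovers the vertical border edges, and with them the shape, from the kind of label on the diagonal.
\<close>

definition vertical_rows :: "nat \<Rightarrow> filling \<Rightarrow> nat set" where
  "vertical_rows m S = {r. r < m \<and> S (r, m - 1 - r) \<in> alpha_gamma}"

lemma row_set_eq_vertical_rows:
  assumes X: "X \<in> labeled_tree_like_tableaux (Suc m)"
  shows "row_set (shape X) = vertical_rows m (to_staircase m X)"
proof (intro set_eqI)
  fix r
  interpret ferrers_diagram "shape X" m by (rule labeled_tree_like_tableauD(1)[OF X])
  note V = labeled_tree_like_tableauD(7)[OF X] and H = labeled_tree_like_tableauD(8)[OF X]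
  show "r \<in> row_set (shape X) \<longleftrightarrow> r \<in> vertical_rows m (to_staircase m X)"
  proof (cases "r < m")
    case True
    then have sum: "r + (m - 1 - r) + 1 = m" by simp
    show ?thesis
    proof (cases r "m - 1 - r" rule: cell_cases)
      case (vedge i)
      then have "to_staircase m X (r, m - 1 - r) \<in> alpha_gamma"
        using V[of i] to_staircase_vedge[OF refl, of i "m - 1 - r"] by simp
      then show ?thesis using True vedge by (auto simp: vertical_rows_def row_set_def)
    next
      case (hedge j)
      then have "to_staircase m X (r, m - 1 - r) \<in> beta_delta"
        using H[of j] to_staircase_hedge[OF refl, of j r] by simp
      then show ?thesis using hedge by (auto simp: vertical_rows_def)
    qed (use sum in auto)
  qed (use row_set_less in \<open>auto simp: vertical_rows_def\<close>)
qed

text \<open>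
  The diagonal of the image gives the shape and the edge labels, the rest of it the inner labels, and
  the inner labels force those of the first row and column.
\<close>

lemma inj_on_to_staircase: "inj_on (to_staircase m) (labeled_tree_like_tableaux (Suc m))"
proof (rule inj_onI)
  fix X Y
  assume X: "X \<in> labeled_tree_like_tableaux (Suc m)" and Y: "Y \<in> labeled_tree_like_tableaux (Suc m)"
    and eq: "to_staircase m X = to_staircase m Y"
  note X' = labeled_tree_like_tableauD[OF X] and Y' = labeled_tree_like_tableauD[OF Y]
  define D where "D = shape X"
  have "row_set (shape X) = row_set (shape Y)"
    using row_set_eq_vertical_rows[OF X] row_set_eq_vertical_rows[OF Y] eq by simp
  then have shape: "shape X = D" "shape Y = D"
    using shape_eq_if_row_set_eq[OF X'(1) Y'(1)] unfolding D_def by simp_all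
  note X' = X'[unfolded shape] and Y' = Y'[unfolded shape]
  interpret ferrers_diagram D m by (rule X'(1))
  have inner: "box_label X (i, j) = box_label Y (i, j)" if "0 < i" "0 < j" for i j
  proof (cases "(i, j) \<in> boxes D")
    case True
    then have "i \<in> {1..<num_rows D}" "j \<in> {1..<num_cols D}"
      using that mem_boxesD[OF True] by simp_all
    from to_staircase_box[OF shape(1) this] to_staircase_box[OF shape(2) this]
    show ?thesis using eq by simp
  next
    case False
    then show ?thesis using X'(2) Y'(2) by (metis domIff subsetD)
  qed
  note row = X'(9) Y'(9) and col = X'(10) Y'(10)
  have border: "box_label X (i, j) \<notin> alpha_gamma \<union> beta_delta" "box_label Y (i, j) \<notin> alpha_gamma \<union> beta_delta"
    if "i = 0 \<or> j = 0" for i j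
    using that row[of j] col[of i] border_label_cases[of D]
    by (metis alpha_gamma_beta_delta_simps(1-4) Un_iff)+
  have mem: "box_label X (i, j) \<in> alpha_gamma \<longleftrightarrow> box_label Y (i, j) \<in> alpha_gamma"
    "box_label X (i, j) \<in> beta_delta \<longleftrightarrow> box_label Y (i, j) \<in> beta_delta" for i j
    using border[of i j] inner[of i j] by (cases "i = 0 \<or> j = 0"; auto)+
  have boxes: "box_label X = box_label Y"
  proof
    fix c :: "nat \<times> nat"
    obtain i j where c: "c = (i, j)" by (cases c)
    show "box_label X c = box_label Y c"
    proof (cases "i = 0 \<or> j = 0")
      case True
      then show ?thesis
        using row[of j] col[of i] unfolding c first_row_label_def first_col_label_def mem by auto
    qed (use inner c in auto)
  qed
  have V: "vedge_label X i = vedge_label Y i" for i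
  proof -
    consider "i = 0" | "i \<in> {1..<num_rows D}" | "\<not> i < num_rows D" by fastforce
    then show ?thesis
    proof cases
      case 2
      then show ?thesis
        using to_staircase_vedge[of X i "m - 1 - row_pos D i"]
          to_staircase_vedge[of Y i "m - 1 - row_pos D i"] shape eq row_pos_less[of i] by simp
    next
      case 3
      then have "i \<notin> dom (vedge_label X)" "i \<notin> dom (vedge_label Y)" using X'(3) Y'(3) by simp_all
      then show ?thesis by (simp add: domIff)
    qed (simp add: X'(5) Y'(5))
  qed
  have H: "hedge_label X j = hedge_label Y j" for j
  proof -
    consider "j = 0" | "j \<in> {1..<num_cols D}" | "\<not> j < num_cols D" by fastforce
    then show ?thesis
    proof cases
      case 2
      then show ?thesis
        using to_staircase_hedge[of X j "m - 1 - col_pos D j"]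
          to_staircase_hedge[of Y j "m - 1 - col_pos D j"] shape eq col_pos_less[of j] by simp
    next
      case 3
      then have "j \<notin> dom (hedge_label X)" "j \<notin> dom (hedge_label Y)" using X'(4) Y'(4) by simp_all
      then show ?thesis by (simp add: domIff)
    qed (simp add: X'(6) Y'(6))
  qed
  have "vedge_label X = vedge_label Y" "hedge_label X = hedge_label Y" using V H by blast+
  then show "X = Y" using shape boxes by (intro ltlt.equality) simp_all
qed

text \<open>
  The preimage takes its shape from the kinds of the diagonal labels and its inner labels from
  the boxes in the rows and columns of the staircase that are occupied. All other boxes above the diagonal are
  empty: their row ends in \<open>\<beta>\<close> or \<open>\<delta>\<close>, or their column ends in \<open>\<alpha>\<close> or
  \<open>\<gamma>\<close>.
\<close>

lemma staircase_tableau_is_image: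
  assumes S: "S \<in> staircase_tableaux m"
  shows "S \<in> to_staircase m ` labeled_tree_like_tableaux (Suc m)"
proof -
  note dom = staircase_tableauD(1)[OF S] and not_one = staircase_tableauD(2)[OF S]
    and diag = staircase_tableauD(3)[OF S] and beta = staircase_tableauD(4)[OF S]
    and alpha = staircase_tableauD(5)[OF S]
  obtain D where D: "ferrers_diagram D m" and rows: "row_set D = vertical_rows m S"
    by (rule ex_shape_with_row_set[of "vertical_rows m S" m]) (auto simp: vertical_rows_def)
  interpret ferrers_diagram D m by (rule D)
  have diag_alpha: "S (r, c) \<in> alpha_gamma" if "r \<in> row_set D" "r + c + 1 = m" for r c
  proof -
    have "c = m - 1 - r" using that by simp
    then show ?thesis using that rows by (auto simp: vertical_rows_def)
  qed
  have diag_beta: "S (r, c) \<in> beta_delta" if "r \<notin> row_set D" "r + c + 1 = m" for r c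
  proof -
    have "c = m - 1 - r" "r < m" using that by simp_all
    then have "S (r, c) \<notin> alpha_gamma" using that rows by (auto simp: vertical_rows_def)
    then show ?thesis using label_cases[of "S (r, c)"] diag[OF that(2)] not_one[of r c] by blast
  qed
  \<comment> \<open>\<open>I\<close> is the inner filling alone; the first row and column of \<open>T\<close> are computed from it.\<close>
  define I where "I = (\<lambda>(i, j). if 0 < i \<and> 0 < j \<and> (i, j) \<in> boxes D
    then S (row_pos D i, col_pos D j) else None)"
  define T where "T = (\<lambda>(i, j). if i = 0 then first_row_label D I j
    else if j = 0 then first_col_label D I i else I (i, j))"
  define V where "V = (\<lambda>i. if i = 0 then Some LOne
    else if i < num_rows D then S (row_pos D i, m - 1 - row_pos D i) else None)"
  define H where "H = (\<lambda>j. if j = 0 then Some LOne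
    else if j < num_cols D then S (m - 1 - col_pos D j, col_pos D j) else None)"
  define X where "X = \<lparr>shape = D, box_label = T, vedge_label = V, hedge_label = H\<rparr>"
  have V_alpha: "V i \<in> alpha_gamma" if "i \<in> {1..<num_rows D}" for i
    using that diag_alpha[of "row_pos D i" "m - 1 - row_pos D i"] row_pos_less[OF that]
    by (simp add: V_def row_set_def)
  have H_beta: "H j \<in> beta_delta" if "j \<in> {1..<num_cols D}" for j
  proof -
    have sum: "(m - 1 - col_pos D j) + col_pos D j + 1 = m" using col_pos_less[OF that] by simp
    have "col_pos D j \<in> col_set D" using that by (auto simp: col_set_def)
    then have "m - 1 - col_pos D j \<notin> row_set D" using mem_col_set_iff[OF sum] by blast
    then show ?thesis using diag_beta[OF _ sum] that by (simp add: H_def)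
  qed
  have border: "T (i, j) \<notin> alpha_gamma" "T (i, j) \<notin> beta_delta" if "i = 0 \<or> j = 0" for i j
    using that by (auto simp: T_def first_row_label_def first_col_label_def)
  have inner: "T (i, j) = I (i, j)" if "0 < i" "0 < j" for i j
    using that by (simp add: T_def)
  have I_border: "I (i, j) = None" if "i = 0 \<or> j = 0" for i j
    using that by (auto simp: I_def)
  have mem: "T (i, j) \<in> alpha_gamma \<longleftrightarrow> I (i, j) \<in> alpha_gamma"
    "T (i, j) \<in> beta_delta \<longleftrightarrow> I (i, j) \<in> beta_delta" for i j
    using border[of i j] inner[of i j] I_border[of i j] by (cases "i = 0 \<or> j = 0"; auto)+
  have I_box: "I (i, j) = S (row_pos D i, col_pos D j)"
    if "i \<in> {1..<num_rows D}" "j \<in> {1..<num_cols D}" for i j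
  proof (cases "(i, j) \<in> boxes D")
    case False
    then have "\<not> row_pos D i + col_pos D j < m" using pos_sum_cases[OF that] by simp
    then have "S (row_pos D i, col_pos D j) = None" using dom by blast
    then show ?thesis using False by (simp add: I_def)
  qed (use that in \<open>auto simp: I_def\<close>)
  have I_index: "i \<in> {1..<num_rows D} \<and> j \<in> {1..<num_cols D}" if "I (i, j) \<noteq> None" for i j
    using that mem_boxesD[of i j] by (auto simp: I_def split: if_splits)
  have "X \<in> labeled_tree_like_tableaux (Suc m)"
    unfolding mem_labeled_tree_like_tableaux_iff Let_def X_def ltlt.simps
  proof (intro conjI allI ballI impI)
    show "dom T \<subseteq> boxes D"
      by (auto simp: T_def I_def first_row_label_def first_col_label_def first_row_col_boxes
          split: if_splits)
    show "dom V = {..<num_rows D}"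
    proof (intro set_eqI)
      fix i show "i \<in> dom V \<longleftrightarrow> i \<in> {..<num_rows D}"
        using V_alpha[of i] rows_cols by (cases "i < num_rows D") (auto simp: V_def)
    qed
    show "dom H = {..<num_cols D}"
    proof (intro set_eqI)
      fix j show "j \<in> dom H \<longleftrightarrow> j \<in> {..<num_cols D}"
        using H_beta[of j] rows_cols by (cases "j < num_cols D") (auto simp: H_def)
    qed
    show "T (0, j) = first_row_label D T j" for j
      unfolding first_row_label_def mem by (simp add: T_def first_row_label_def)
    show "T (i, 0) = first_col_label D T i" for i
    proof (cases "i = 0")
      case True
      then show ?thesis
        using I_border rows_cols unfolding first_col_label_def mem
        by (simp add: T_def first_row_label_def)
    next
      case False
      then show ?thesis unfolding first_col_label_def mem by (simp add: T_def first_col_label_def)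
    qed
    show "T (i, j) \<noteq> Some LOne" if "0 < i" "0 < j" for i j
      using that not_one by (simp add: T_def I_def)
    show "T (i', j) = None" if "T (i, j) \<in> alpha_gamma" "0 < i'" "i' < i" for i j i'
    proof -
      have ij: "I (i, j) \<in> alpha_gamma" using that mem by blast
      then have idx: "i \<in> {1..<num_rows D}" "j \<in> {1..<num_cols D}" using I_index[of i j] by auto
      have idx': "i' \<in> {1..<num_rows D}" using idx that by auto
      have "S (row_pos D i', col_pos D j) = None"
        using alpha[of "row_pos D i" "col_pos D j" "row_pos D i'"] ij I_box[OF idx]
          row_pos_less_iff[OF idx' idx(1)] that by simp
      then show ?thesis using I_box[OF idx' idx(2)] inner that idx by simp
    qed
    show "T (i, j') = None" if "T (i, j) \<in> beta_delta" "0 < j'" "j' < j" for i j j'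
    proof -
      have ij: "I (i, j) \<in> beta_delta" using that mem by blast
      then have idx: "i \<in> {1..<num_rows D}" "j \<in> {1..<num_cols D}" using I_index[of i j] by auto
      have idx': "j' \<in> {1..<num_cols D}" using idx that by auto
      have "S (row_pos D i, col_pos D j') = None"
        using beta[of "row_pos D i" "col_pos D j" "col_pos D j'"] ij I_box[OF idx]
          col_pos_less_iff[OF idx' idx(2)] that by simp
      then show ?thesis using I_box[OF idx(1) idx'] inner that idx by simp
    qed
  qed (use D V_alpha H_beta in \<open>simp_all add: V_def H_def\<close>)
  moreover have "to_staircase m X (r, c) = S (r, c)" for r c
  proof -
    have shape: "shape X = D" by (simp add: X_def)
    show ?thesis
    proof (cases r c rule: cell_cases)
      case (box i j)
      then show ?thesis
        using to_staircase_box[OF shape, of i j] I_box[of i j] inner[of i j] by (simp add: X_def)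
    next
      case (vedge i)
      then have "m - 1 - row_pos D i = c" by simp
      then show ?thesis
        using vedge to_staircase_vedge[OF shape, of i c] by (simp add: X_def V_def)
    next
      case (hedge j)
      then have "m - 1 - col_pos D j = r" by simp
      then show ?thesis
        using hedge to_staircase_hedge[OF shape, of j r] by (simp add: X_def H_def)
    next
      case outside
      have "S (r, c) = None"
      proof (rule ccontr)
        assume nonempty: "S (r, c) \<noteq> None"
        then have less: "r + c + 1 < m" using dom[of r c] outside by simp
        have "r \<in> row_set D"
        proof (rule ccontr)
          assume "r \<notin> row_set D"
          then have "S (r, m - 1 - r) \<in> beta_delta" using diag_beta[of r "m - 1 - r"] less by simp
          moreover have "c < m - 1 - r" using less by simp
          ultimately show False using beta nonempty by metis
        qed
        moreover have "c \<in> col_set D"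
        proof (rule ccontr)
          assume "c \<notin> col_set D"
          then have "m - 1 - c \<in> row_set D" using mem_col_set_iff[of "m - 1 - c" c] less by simp
          then have "S (m - 1 - c, c) \<in> alpha_gamma"
            using diag_alpha[of "m - 1 - c" c] less by simp
          moreover have "r < m - 1 - c" using less by simp
          ultimately show False using alpha nonempty by metis
        qed
        ultimately show False using outside by blast
      qed
      then show ?thesis using to_staircase_None[OF shape] outside by simp
    qed
  qed
  then have "to_staircase m X = S" by (intro ext) auto
  ultimately show ?thesis by blast
qed

theorem proposition1p4:
  fixes n :: nat
  assumes "n \<ge> 2"
  shows "\<exists>f. bij_betw f (labeled_tree_like_tableaux n) (staircase_tableaux (n - 1))"
proof
  have "bij_betw (to_staircase m) (labeled_tree_like_tableaux (Suc m)) (staircase_tableaux m)" for m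
    unfolding bij_betw_def
    using inj_on_to_staircase to_staircase_in_staircase_tableaux staircase_tableau_is_image by blast
  from this[of "n - 1"]
  show "bij_betw (to_staircase (n - 1)) (labeled_tree_like_tableaux n) (staircase_tableaux (n - 1))"
    using assms by simp
qed

end
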